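(* Let $r$ be a positive integer and let $\mathcal{G}$ be a family of graphs with bounded maximum degree (i.e. there is a constant $D$ with $\Delta(G)\le D$ for all $G\in\mathcal{G}$) such that no $G\in\mathcal{G}$ has a $K_r$ minor. Then $\mathrm{sn}(G)=O(\sqrt{n})$ for $G\in\mathcal{G}$: there is a constant $C$ such that $\mathrm{sn}(G)\le C\sqrt{n}$ for every $G\in\mathcal{G}$ with $n=|V(G)|$ vertices.
   Context: A graph is a finite, connected, loopless multigraph; $\Delta(G)$ is its maximum degree and $K_r$ is the complete graph on $r$ vertices. A minor is a graph obtained by vertex deletions, edge deletions and edge contractions. A scramble $\mathcal{S}$ on $G$ is a nonempty collection (set) of nonempty connected subgraphs of $G$, called eggs. The hitting number $h(\mathcal{S})$ is the minimum size of a set of vertices meeting the vertex set of every egg. An egg-cut is a set of edges whose deletion disconnects $G$ so that two different components each contain an egg; the egg-cut number $e(\mathcal{S})$ is the minimum size of an egg-cut, with $e(\mathcal{S})=\infty$ if none exists. The order is $\|\mathcal{S}\|=\min\{h(\mathcal{S}),e(\mathcal{S})\}$. The scramble number $\mathrm{sn}(G)$ is the maximum order of a scramble on $G$. *)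

theory Defs
  imports
    "Graph_Theory.Digraph_Component"
    "HOL-Library.Extended_Real"
begin

text \<open>
  Undirected multigraphs are represented by directed multigraphs: every arc stands for exactly one
  undirected edge, and its orientation is an arbitrary choice.  No notion below depends on the
  orientation; in particular \<^const>\<open>Digraph_Component.connected\<close> is connectivity of the
  underlying undirected graph and entails that there is at least one vertex.
\<close>

locale multigraph = fin_digraph G + loopfree_digraph G
  for G :: "('a, 'b) pre_digraph" (structure) +
  assumes conn: "Digraph_Component.connected G"

definition degree :: "('a, 'b) pre_digraph \<Rightarrow> 'a \<Rightarrow> nat" where
  "degree G v = in_degree G v + out_degree G v"

definition max_degree :: "('a, 'b) pre_digraph \<Rightarrow> nat" where
  "max_degree G = Max (degree G ` verts G)"

text \<open>
  Contraction keeps the tail of the contracted edge as the name of the merged vertex.  Edges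
  parallel to it become loops, which a later edge deletion may remove.
\<close>

definition contract_arc :: "('a, 'b) pre_digraph \<Rightarrow> 'b \<Rightarrow> ('a, 'b) pre_digraph" where
  "contract_arc G e =
     (let \<phi> = (\<lambda>x. if x = head G e then tail G e else x)
      in \<lparr> verts = \<phi> ` verts G, arcs = arcs G - {e}, tail = \<phi> \<circ> tail G, head = \<phi> \<circ> head G \<rparr>)"

inductive minor :: "('a, 'b) pre_digraph \<Rightarrow> ('a, 'b) pre_digraph \<Rightarrow> bool" where
  refl: "minor G G"
| del_vert: "minor H G \<Longrightarrow> v \<in> verts H \<Longrightarrow> minor (pre_digraph.del_vert H v) G"
| del_arc: "minor H G \<Longrightarrow> e \<in> arcs H \<Longrightarrow> minor (pre_digraph.del_arc H e) G"
| contract: "minor H G \<Longrightarrow> e \<in> arcs H \<Longrightarrow> tail H e \<noteq> head H e \<Longrightarrow> minor (contract_arc H e) G"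

text \<open>
  The library's \<open>complete_digraph\<close> has two opposite arcs between distinct vertices and hence would
  be a doubled complete graph in the present encoding.
\<close>

definition complete_multigraph :: "nat \<Rightarrow> ('a, 'b) pre_digraph \<Rightarrow> bool" where
  "complete_multigraph r H \<longleftrightarrow>
     fin_digraph H \<and> loopfree_digraph H \<and> card (verts H) = r \<and>
     (\<forall>u \<in> verts H. \<forall>v \<in> verts H. u \<noteq> v \<longrightarrow> (\<exists>!e. e \<in> arcs H \<and> {tail H e, head H e} = {u, v}))"

definition has_complete_minor :: "nat \<Rightarrow> ('a, 'b) pre_digraph \<Rightarrow> bool" where
  "has_complete_minor r G \<longleftrightarrow> (\<exists>H. minor H G \<and> complete_multigraph r H)"

definition scramble :: "('a, 'b) pre_digraph \<Rightarrow> ('a, 'b) pre_digraph set \<Rightarrow> bool" where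
  "scramble G S \<longleftrightarrow> S \<noteq> {} \<and> (\<forall>H \<in> S. subgraph H G \<and> Digraph_Component.connected H)"

definition hitting_set :: "('a, 'b) pre_digraph \<Rightarrow> ('a, 'b) pre_digraph set \<Rightarrow> 'a set \<Rightarrow> bool" where
  "hitting_set G S U \<longleftrightarrow> U \<subseteq> verts G \<and> (\<forall>H \<in> S. U \<inter> verts H \<noteq> {})"

definition hitting_number :: "('a, 'b) pre_digraph \<Rightarrow> ('a, 'b) pre_digraph set \<Rightarrow> enat" where
  "hitting_number G S = (INF U \<in> Collect (hitting_set G S). enat (card U))"

definition delete_arcs :: "('a, 'b) pre_digraph \<Rightarrow> 'b set \<Rightarrow> ('a, 'b) pre_digraph" where
  "delete_arcs G F = G \<lparr> arcs := arcs G - F \<rparr>"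

definition component :: "('a, 'b) pre_digraph \<Rightarrow> ('a, 'b) pre_digraph \<Rightarrow> bool" where
  "component G C \<longleftrightarrow> pre_digraph.max_subgraph G Digraph_Component.connected C"

definition egg_cut :: "('a, 'b) pre_digraph \<Rightarrow> ('a, 'b) pre_digraph set \<Rightarrow> 'b set \<Rightarrow> bool" where
  "egg_cut G S F \<longleftrightarrow> F \<subseteq> arcs G \<and>
     (\<exists>C\<^sub>1 C\<^sub>2. component (delete_arcs G F) C\<^sub>1 \<and> component (delete_arcs G F) C\<^sub>2 \<and> C\<^sub>1 \<noteq> C\<^sub>2 \<and>
        (\<exists>H \<in> S. subgraph H C\<^sub>1) \<and> (\<exists>H \<in> S. subgraph H C\<^sub>2))"

text \<open>The infimum of the empty set is \<^term>\<open>\<infinity> :: enat\<close>.\<close>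

definition egg_cut_number :: "('a, 'b) pre_digraph \<Rightarrow> ('a, 'b) pre_digraph set \<Rightarrow> enat" where
  "egg_cut_number G S = (INF F \<in> Collect (egg_cut G S). enat (card F))"

definition scramble_order :: "('a, 'b) pre_digraph \<Rightarrow> ('a, 'b) pre_digraph set \<Rightarrow> enat" where
  "scramble_order G S = min (hitting_number G S) (egg_cut_number G S)"

text \<open>The supremum is a maximum, see \<open>scramble_number_attained\<close> below.\<close>

definition scramble_number :: "('a, 'b) pre_digraph \<Rightarrow> enat" where
  "scramble_number G = (SUP S \<in> Collect (scramble G). scramble_order G S)"

lemma scramble_order_le_card_verts:
  assumes "scramble G S"
  shows "scramble_order G S \<le> enat (card (verts G))"
proof -
  have "hitting_set G S (verts G)"
    using assms
    by (fastforce simp: scramble_def hitting_set_def subgraph_def Digraph_Component.connected_def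
        strongly_connected_def mk_symmetric_def)
  then have "hitting_number G S \<le> enat (card (verts G))"
    unfolding hitting_number_def by (intro INF_lower) simp
  then show ?thesis
    unfolding scramble_order_def by (simp add: min.coboundedI1)
qed

lemma scramble_number_attained:
  assumes "multigraph G"
  obtains S where "scramble G S" "scramble_number G = scramble_order G S"
proof -
  let ?A = "scramble_order G ` Collect (scramble G)"
  interpret multigraph G by fact
  have "scramble G {G}"
    using conn wf_digraph by (simp add: scramble_def subgraph_def compatible_def)
  then have ne: "?A \<noteq> {}" by blast
  have fin: "finite ?A"
    by (rule finite_enat_bounded[of _ "card (verts G)"]) (auto simp: scramble_order_le_card_verts)
  have "scramble_number G \<in> ?A"
    unfolding scramble_number_def using Max_in[OF fin ne] Max_Sup[OF fin ne] by simp
  then show ?thesis using that by auto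
qed

end

theory Submission
  imports Defs
begin

text \<open>
  Let a scramble have order greater than \<open>(D + 1) r s\<close>, where \<open>s\<close> is about \<open>sqrt (r n)\<close>.  After the
  removal of a set \<open>X\<close> of at most \<open>r s\<close> vertices some egg survives, because \<open>X\<close> is not a hitting
  set, and all surviving eggs lie in one component of \<open>G - X\<close>, because the at most \<open>D r s\<close> edges at
  \<open>X\<close> are not an egg-cut.  The scramble thus yields a haven, and the argument of Alon, Seymour and
  Thomas (A separator theorem for nonplanar graphs, 1990) produces a \<open>K\<^sub>r\<close> minor: maintain disjoint,
  connected, pairwise adjacent branch sets and a set \<open>X\<close> of at most \<open>s\<close> vertices from each of them,
  such that the component \<open>B\<close> of \<open>G - X\<close> that contains the surviving eggs avoids the branch sets.
  If every branch set has a neighbour in \<open>B\<close>, then either a connected subset of \<open>B\<close> of size at most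
  \<open>s\<close> touches all of them and becomes a new branch set, or a separator of size at most \<open>s\<close> cuts off
  the eggs from some branch set, which is then enlarged to contain the relevant part of the
  separator.  In either case \<open>B\<close> shrinks.
\<close>

section \<open>Linked vertex sets\<close>

text \<open>Connectivity is stated through cuts rather than paths, so that arguments about growing
  or separating sets only handle one crossing edge at a time.\<close>

definition linked :: "('a \<Rightarrow> 'a \<Rightarrow> bool) \<Rightarrow> 'a set \<Rightarrow> bool" where
  "linked E K \<longleftrightarrow> K \<noteq> {} \<and> (\<forall>S. S \<noteq> {} \<and> S \<subset> K \<longrightarrow> (\<exists>u \<in> S. \<exists>v \<in> K - S. E u v))"

lemma linked_cross:
  assumes "linked E K" "a \<in> K" "a \<in> S" "b \<in> K" "b \<notin> S"
  obtains u v where "u \<in> K \<inter> S" "v \<in> K - S" "E u v"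
proof -
  have "K \<inter> S \<noteq> {}" "K \<inter> S \<subset> K"
    using assms by auto
  then show ?thesis
    using assms(1) that unfolding linked_def by (metis DiffE DiffI IntI)
qed

lemma linked_singleton [simp]: "linked E {x}"
  unfolding linked_def by auto

text \<open>Otherwise \<open>B\<close> would cut \<open>K\<close>, and the crossing edge would leave
  \<open>B\<close>. This traps a connected set inside a component.\<close>

lemma linked_subset_closed:
  assumes "linked E K" "K \<inter> B \<noteq> {}" "\<And>u v. u \<in> B \<Longrightarrow> v \<in> K \<Longrightarrow> E u v \<Longrightarrow> v \<in> B"
  shows "K \<subseteq> B"
proof
  fix x assume x: "x \<in> K"
  show "x \<in> B"
  proof (rule ccontr)
    assume "x \<notin> B"
    moreover obtain a where "a \<in> K" "a \<in> B"
      using assms(2) by auto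
    ultimately obtain u v where "u \<in> K \<inter> B" "v \<in> K - B" "E u v"
      using linked_cross[OF assms(1)] x by metis
    then show False
      using assms(3) by auto
  qed
qed

locale sym_relation =
  fixes E :: "'a \<Rightarrow> 'a \<Rightarrow> bool"
  assumes sym: "E u v \<Longrightarrow> E v u"
begin

text \<open>By symmetry a cut may be replaced by its complement, so only the cuts around a base
  point matter.\<close>

lemma linkedI:
  assumes x: "x \<in> K" and cross: "\<And>S. x \<in> S \<Longrightarrow> S \<subset> K \<Longrightarrow> \<exists>u \<in> S. \<exists>v \<in> K - S. E u v"
  shows "linked E K"
  unfolding linked_def
proof (intro conjI allI impI)
  show "K \<noteq> {}" using x by auto
  fix S assume S: "S \<noteq> {} \<and> S \<subset> K"
  show "\<exists>u \<in> S. \<exists>v \<in> K - S. E u v"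
  proof (cases "x \<in> S")
    case True
    then show ?thesis using cross S by blast
  next
    case False
    then have "x \<in> K - S" "K - S \<subset> K"
      using x S by auto
    then obtain u v where "u \<in> K - S" "v \<in> K - (K - S)" "E u v"
      using cross by metis
    then show ?thesis using sym by auto
  qed
qed

text \<open>A cut around a point of \<open>C\<close> either splits \<open>C\<close> or contains it.
  In the second case it splits some piece or is crossed by the edge joining \<open>C\<close> to that
  piece.\<close>

lemma linked_Union:
  assumes C: "linked E C"
    and F: "\<And>K. K \<in> F \<Longrightarrow> linked E K \<and> (\<exists>u \<in> C. \<exists>v \<in> K. u = v \<or> E u v)"
  shows "linked E (C \<union> \<Union>F)"
proof -
  obtain x where x: "x \<in> C"
    using C unfolding linked_def by auto
  show ?thesis
  proof (rule linkedI[of x])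
    show "x \<in> C \<union> \<Union>F" using x by simp
    fix S assume S: "x \<in> S" "S \<subset> C \<union> \<Union>F"
    show "\<exists>u \<in> S. \<exists>v \<in> C \<union> \<Union>F - S. E u v"
    proof (cases "C \<subseteq> S")
      case False
      then obtain y where "y \<in> C" "y \<notin> S" by auto
      then obtain u v where "u \<in> C \<inter> S" "v \<in> C - S" "E u v"
        using linked_cross[OF C] x S(1) by metis
      then show ?thesis by blast
    next
      case True
      then obtain y K where y: "K \<in> F" "y \<in> K" "y \<notin> S"
        using S by auto
      obtain u v where uv: "u \<in> C" "v \<in> K" "u = v \<or> E u v"
        using F y(1) by blast
      show ?thesis
      proof (cases "v \<in> S")
        case True
        then obtain u' v' where "u' \<in> K \<inter> S" "v' \<in> K - S" "E u' v'"
          using linked_cross[of E K v S y] F y uv(2) by metis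
        then show ?thesis using y(1) by blast
      next
        case False
        then have "E u v" "u \<in> S"
          using uv \<open>C \<subseteq> S\<close> by auto
        then show ?thesis using False uv(2) y(1) by blast
      qed
    qed
  qed
qed

lemma linked_insert:
  assumes "linked E K" "u \<in> K" "E u v"
  shows "linked E (insert v K)"
  using linked_Union[of K "{{v}}"] assms by auto

text \<open>The component is the union of all linked sets between \<open>H\<close> and
  \<open>U\<close>. Adding a neighbour gives another such set, hence the closure property.\<close>

lemma linked_component:
  assumes H: "linked E H" "H \<subseteq> U"
  obtains B where "H \<subseteq> B" "B \<subseteq> U" "linked E B" "\<And>u v. u \<in> B \<Longrightarrow> v \<in> U \<Longrightarrow> E u v \<Longrightarrow> v \<in> B"
proof -
  define F where "F = {K. linked E K \<and> H \<subseteq> K \<and> K \<subseteq> U}"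
  have HF: "H \<in> F"
    using H by (auto simp: F_def)
  have "linked E (H \<union> \<Union>F)"
  proof (rule linked_Union[OF H(1)])
    fix K assume "K \<in> F"
    moreover have "H \<noteq> {}"
      using H(1) by (auto simp: linked_def)
    ultimately show "linked E K \<and> (\<exists>u \<in> H. \<exists>v \<in> K. u = v \<or> E u v)"
      unfolding F_def by blast
  qed
  moreover have "H \<union> \<Union>F = \<Union>F"
    using HF by auto
  ultimately have linked: "linked E (\<Union>F)" by simp
  show thesis
  proof (rule that[of "\<Union>F"])
    fix u v assume uv: "u \<in> \<Union>F" "v \<in> U" "E u v"
    then obtain K where K: "u \<in> K" "K \<in> F" by auto
    then have "insert v K \<in> F"
      using linked_insert uv unfolding F_def by blast
    then show "v \<in> \<Union>F" by auto
  qed (use HF linked in \<open>auto simp: F_def\<close>)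
qed

text \<open>
  \<open>P t i v\<close> says that the least size of a linked set through \<open>v\<close> meeting the first \<open>i\<close> of the sets
  is at most \<open>t\<close>.  This size changes by at most one along an edge, so the vertices where it equals
  \<open>t\<close> for some \<open>i\<close> form a separator; these level sets are disjoint for distinct \<open>t\<close> and fixed \<open>i\<close>,
  so one of them is small.
\<close>

lemma small_linked_set_or_separator:
  fixes A :: "nat \<Rightarrow> 'a set"
  assumes "finite B" "B \<noteq> {}" "0 < m"
  obtains
    (linked_set) T where "linked E T" "T \<subseteq> B" "card T \<le> m" "\<And>i. i < k \<Longrightarrow> T \<inter> A i \<noteq> {}"
  | (separator) Z where "Z \<subseteq> B" "m * card Z \<le> k * card B"
      "\<And>K. linked E K \<Longrightarrow> K \<subseteq> B - Z \<Longrightarrow> \<exists>i<k. K \<inter> A i = {}"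
proof (cases "\<exists>T. linked E T \<and> T \<subseteq> B \<and> card T \<le> m \<and> (\<forall>i<k. T \<inter> A i \<noteq> {})")
  case True
  then show ?thesis using linked_set by blast
next
  case no_set: False
  define P where "P t i v \<longleftrightarrow>
    (\<exists>T. linked E T \<and> v \<in> T \<and> T \<subseteq> B \<and> card T \<le> t \<and> (\<forall>j<i. T \<inter> A j \<noteq> {}))" for t i v
  have P_mono: "P t' i v" if "P t i v" "t \<le> t'" for t t' i v
    using that unfolding P_def by (meson order_trans)
  have P_step: "P (Suc t) i w" if Pv: "P t i v" and vw: "E v w" and w: "w \<in> B" for t i v w
  proof -
    obtain T where T: "linked E T" "v \<in> T" "T \<subseteq> B" "card T \<le> t" "\<forall>j<i. T \<inter> A j \<noteq> {}"
      using Pv unfolding P_def by blast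
    have "card (insert w T) \<le> Suc t"
      using T(4) by (metis Suc_le_mono card_insert_le_m1 card_insert_if le_Suc_eq
          finite_subset[OF T(3) assms(1)])
    then show ?thesis
      unfolding P_def using T w linked_insert[OF T(1,2) vw]
      by (intro exI[of _ "insert w T"]) auto
  qed
  \<comment> \<open>The index starts at 1: for \<open>i = 0\<close> nothing has to be met,
    singletons qualify, and \<open>Z 1\<close> would be all of \<open>B\<close>.\<close>
  define Z where "Z t = {v \<in> B. \<exists>i\<in>{1..k}. P t i v \<and> \<not> P (t - 1) i v}" for t
  define L where "L i t = {v \<in> B. P t i v \<and> \<not> P (t - 1) i v}" for i t
  have L_disjoint: "L i t \<inter> L i t' = {}" if "t \<noteq> t'" for i t t'
  proof -
    have aux: "L i t \<inter> L i t' = {}" if "t < t'" for t t'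
    proof -
      have "t \<le> t' - 1" using that by simp
      then show ?thesis
        using P_mono unfolding L_def by auto
    qed
    show ?thesis
      using aux[of t t'] aux[of t' t] that by (cases "t < t'") auto
  qed
  have fin_L: "finite (L i t)" for i t
    using assms(1) by (simp add: L_def)
  have "(\<Sum>t=1..m. card (Z t)) \<le> (\<Sum>t=1..m. \<Sum>i=1..k. card (L i t))"
  proof (rule sum_mono)
    fix t
    have "Z t = (\<Union>i\<in>{1..k}. L i t)"
      unfolding Z_def L_def by auto
    then show "card (Z t) \<le> (\<Sum>i=1..k. card (L i t))"
      by (simp add: card_UN_le)
  qed
  also have "\<dots> = (\<Sum>i=1..k. \<Sum>t=1..m. card (L i t))"
    by (rule sum.swap)
  also have "\<dots> \<le> (\<Sum>i=1..k. card B)"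
  proof (rule sum_mono)
    fix i
    have "(\<Sum>t=1..m. card (L i t)) = card (\<Union>t\<in>{1..m}. L i t)"
      using L_disjoint fin_L by (subst card_UN_disjoint) auto
    also have "\<dots> \<le> card B"
      by (rule card_mono[OF assms(1)]) (auto simp: L_def)
    finally show "(\<Sum>t=1..m. card (L i t)) \<le> card B" .
  qed
  finally have total: "(\<Sum>t=1..m. card (Z t)) \<le> k * card B" by simp
  \<comment> \<open>Averaging over the \<open>m\<close> candidates \<open>Z t\<close>, whose sizes
    add up to at most \<open>k * card B\<close>.\<close>
  obtain t where t: "t \<in> {1..m}" "m * card (Z t) \<le> k * card B"
  proof (rule ccontr)
    assume "\<not> thesis"
    then have "\<forall>t\<in>{1..m}. k * card B < m * card (Z t)"
      using that by force
    then have "(\<Sum>t=1..m. k * card B) < (\<Sum>t=1..m. m * card (Z t))"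
      using assms(3) by (intro sum_strict_mono) auto
    then show False
      using total assms(3) by (simp flip: sum_distrib_left)
  qed
  show ?thesis
  proof (rule separator[of "Z t"])
    show "Z t \<subseteq> B" by (auto simp: Z_def)
    show "m * card (Z t) \<le> k * card B" by (rule t)
    fix K assume K: "linked E K" "K \<subseteq> B - Z t"
    show "\<exists>i<k. K \<inter> A i = {}"
    proof (rule ccontr)
      assume "\<not> ?thesis"
      then have meets: "K \<inter> A i \<noteq> {}" if "i < k" for i using that by blast
      have down: "P (t - 1) i v" if "v \<in> K" "P t i v" "1 \<le> i" "i \<le> k" for i v
      proof -
        have "v \<in> B" "v \<notin> Z t" "i \<in> {1..k}" using that K(2) by auto
        then show ?thesis using \<open>P t i v\<close> unfolding Z_def by blast
      qed
      \<comment> \<open>Induction on the number of sets met. A witness through a vertex of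
        \<open>A i\<close> meets \<open>A i\<close> for free, and avoiding \<open>Z t\<close> lowers
        its bound to \<open>t - 1\<close>. Along an edge of \<open>K\<close> the bound rises to
        \<open>t\<close> again, and avoiding \<open>Z t\<close> at the other end restores
        \<open>t - 1\<close>.\<close>
      have "\<forall>v\<in>K. P t i v" if "i \<le> k" for i
        using that
      proof (induction i)
        case 0
        have "P t 0 v" if "v \<in> K" for v
          using that K(2) t(1) unfolding P_def by (intro exI[of _ "{v}"]) auto
        then show ?case by simp
      next
        case (Suc i)
        obtain a where a: "a \<in> K" "a \<in> A i"
          using meets[of i] Suc.prems by auto
        have "P t i a" using Suc a by simp
        then have "P t (Suc i) a"
          unfolding P_def using a(2) by (metis disjoint_iff less_antisym)
        then have base: "P (t - 1) (Suc i) a"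
          using down[of a "Suc i"] a Suc.prems by simp
        have "K \<subseteq> {v. P (t - 1) (Suc i) v}"
        proof (rule linked_subset_closed[OF K(1)])
          show "K \<inter> {v. P (t - 1) (Suc i) v} \<noteq> {}"
            using a base by auto
          fix u v assume uv: "u \<in> {v. P (t - 1) (Suc i) v}" "v \<in> K" "E u v"
          then have "P (Suc (t - 1)) (Suc i) v"
            using P_step K(2) by blast
          then have "P t (Suc i) v" using t(1) by simp
          then show "v \<in> {v. P (t - 1) (Suc i) v}"
            using down[of v "Suc i"] uv Suc.prems by simp
        qed
        then show ?case
          using P_mono[of "t - 1" "Suc i" _ t] by auto
      qed
      moreover obtain v where "v \<in> K"
        using K(1) unfolding linked_def by auto
      ultimately have "P t k v" by simp
      then show False
        using no_set t(1) unfolding P_def by (meson atLeastAtMost_iff order_trans)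
    qed
  qed
qed

end

section \<open>Complete minor models from havens\<close>

text \<open>The members of \<open>M\<close> are the branch sets of a complete minor on
  \<open>card M\<close> vertices.\<close>

definition complete_model :: "('a \<Rightarrow> 'a \<Rightarrow> bool) \<Rightarrow> 'a set set \<Rightarrow> bool" where
  "complete_model E M \<longleftrightarrow>
     (\<forall>C \<in> M. linked E C) \<and> pairwise (\<lambda>C D. C \<inter> D = {} \<and> (\<exists>u \<in> C. \<exists>v \<in> D. E u v)) M"

lemma complete_model_subset: "complete_model E M \<Longrightarrow> N \<subseteq> M \<Longrightarrow> complete_model E N"
  unfolding complete_model_def by (meson pairwise_subset subset_iff)

lemma complete_modelD:
  assumes "complete_model E M" "C \<in> M" "D \<in> M" "C \<noteq> D"
  shows "C \<inter> D = {}" "\<exists>u \<in> C. \<exists>v \<in> D. E u v"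
proof -
  have "pairwise (\<lambda>C D. C \<inter> D = {} \<and> (\<exists>u \<in> C. \<exists>v \<in> D. E u v)) M"
    using assms(1) by (simp add: complete_model_def)
  from pairwiseD[OF this assms(2-4)]
  show "C \<inter> D = {}" "\<exists>u \<in> C. \<exists>v \<in> D. E u v" by simp_all
qed

text \<open>Enlarging a branch set keeps its adjacencies; only connectivity and disjointness are at
  stake.\<close>

lemma complete_model_replace:
  assumes "complete_model E M" "C \<in> M" "C \<subseteq> C'" "linked E C'"
    and disj: "\<And>D. D \<in> M - {C} \<Longrightarrow> D \<inter> C' = {}"
  shows "complete_model E (insert C' (M - {C}))"
proof -
  have P: "complete_model E (M - {C})"
    by (rule complete_model_subset[OF assms(1)]) auto
  have "D \<inter> C' = {} \<and> (\<exists>u \<in> D. \<exists>v \<in> C'. E u v)" "\<exists>u \<in> C'. \<exists>v \<in> D. E u v" if D: "D \<in> M - {C}" for D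
  proof -
    have "\<exists>u \<in> D. \<exists>v \<in> C. E u v" "\<exists>u \<in> C. \<exists>v \<in> D. E u v"
      using complete_modelD(2)[OF assms(1)] assms(2) D by auto
    then show "D \<inter> C' = {} \<and> (\<exists>u \<in> D. \<exists>v \<in> C'. E u v)" "\<exists>u \<in> C'. \<exists>v \<in> D. E u v"
      using disj[OF D] assms(3) by blast+
  qed
  then have "pairwise (\<lambda>C D. C \<inter> D = {} \<and> (\<exists>u \<in> C. \<exists>v \<in> D. E u v)) (insert C' (M - {C}))"
    using P unfolding complete_model_def pairwise_insert by (simp add: Int_commute)
  then show ?thesis
    using P assms(4) unfolding complete_model_def by simp
qed

lemma (in sym_relation) complete_model_insert:
  assumes "complete_model E M" "linked E T" "\<And>C. C \<in> M \<Longrightarrow> C \<inter> T = {} \<and> (\<exists>u \<in> C. \<exists>v \<in> T. E u v)"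
  shows "complete_model E (insert T M)"
  using assms sym unfolding complete_model_def pairwise_insert by (simp add: Int_commute) blast

text \<open>
  The last assumption says that the eggs avoiding a small set \<open>X\<close> lie in a single component after
  the removal of \<open>X\<close>, that is, the eggs induce a haven.
\<close>

locale egg_family = sym_relation E for E :: "'a \<Rightarrow> 'a \<Rightarrow> bool" +
  fixes V :: "'a set" and eggs :: "'a set set" and w :: nat
  assumes finite_V: "finite V"
    and in_V: "E u v \<Longrightarrow> v \<in> V"
    and egg: "H \<in> eggs \<Longrightarrow> linked E H \<and> H \<subseteq> V"
    and avoid: "X \<subseteq> V \<Longrightarrow> card X \<le> w \<Longrightarrow> \<exists>H \<in> eggs. H \<inter> X = {}"
    and no_split: "X \<subseteq> V \<Longrightarrow> card X \<le> w \<Longrightarrow> B \<inter> X = {} \<Longrightarrow>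
      (\<And>u v. u \<in> B \<Longrightarrow> E u v \<Longrightarrow> v \<in> B \<union> X) \<Longrightarrow>
      H \<in> eggs \<Longrightarrow> H \<subseteq> B \<Longrightarrow> H' \<in> eggs \<Longrightarrow> H' \<inter> X = {} \<Longrightarrow> H' \<inter> B \<noteq> {}"
begin

section \<open>Bays: components of \<open>V - X\<close> that contain an egg\<close>

definition bay :: "'a set \<Rightarrow> 'a set \<Rightarrow> bool" where
  "bay X B \<longleftrightarrow> X \<subseteq> V \<and> B \<subseteq> V \<and> linked E B \<and> B \<inter> X = {} \<and>
     (\<forall>u \<in> B. \<forall>v. E u v \<longrightarrow> v \<in> B \<union> X) \<and> (\<exists>H \<in> eggs. H \<subseteq> B)"

text \<open>Some egg avoids \<open>X \<union> Z\<close>; let \<open>B'\<close> be its component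
  after the removal of \<open>X \<union> Z\<close>. The egg also avoids \<open>X\<close>, so
  \<open>no_split\<close> makes it meet \<open>B\<close>. Hence \<open>B'\<close> meets
  \<open>B\<close>, and it cannot leave \<open>B\<close> without passing through
  \<open>X\<close>.\<close>

lemma bay_shrink:
  assumes B: "bay X B" and Z: "Z \<subseteq> B" and card: "card (X \<union> Z) \<le> w"
  obtains B' where "bay (X \<union> Z) B'" "B' \<subseteq> B"
proof -
  have XV: "X \<subseteq> V" "X \<union> Z \<subseteq> V"
    using B Z unfolding bay_def by auto
  obtain H where H: "H \<in> eggs" "H \<inter> (X \<union> Z) = {}"
    using avoid[OF XV(2) card] by auto
  have HV: "linked E H" "H \<subseteq> V - (X \<union> Z)"
    using egg[OF H(1)] H(2) by auto
  obtain B' where B': "H \<subseteq> B'" "B' \<subseteq> V - (X \<union> Z)" "linked E B'"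
    "\<And>u v. u \<in> B' \<Longrightarrow> v \<in> V - (X \<union> Z) \<Longrightarrow> E u v \<Longrightarrow> v \<in> B'"
    using linked_component[OF HV] by metis
  have bay': "bay (X \<union> Z) B'"
    unfolding bay_def using B' H(1) XV in_V by blast
  have "card X \<le> card (X \<union> Z)"
    using finite_subset[OF XV(2) finite_V] by (intro card_mono) auto
  then have "card X \<le> w" using card by simp
  obtain H0 where H0: "H0 \<in> eggs" "H0 \<subseteq> B"
    using B unfolding bay_def by blast
  have "H \<inter> B \<noteq> {}"
    using no_split[of X B H0 H] B H H0 \<open>card X \<le> w\<close> unfolding bay_def by blast
  then have "B' \<inter> B \<noteq> {}" using B'(1) by blast
  then have "B' \<subseteq> B"
    using linked_subset_closed[OF B'(3), of B] B B'(2) unfolding bay_def by blast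
  then show thesis using that bay' by blast
qed

text \<open>
  If a part \<open>B'\<close> of the bay, cut off by a separator \<open>Z\<close>, has lost contact to the branch set \<open>C\<close>, then
  \<open>C\<close> can swallow \<open>Z\<close>: it grows by the components of \<open>B - B'\<close> that it touches, and the other
  components are added to \<open>B'\<close>.
\<close>

lemma bay_swallow:
  assumes B: "bay X B" and B': "bay (X \<union> Z) B'" "B' \<subseteq> B" and Z: "Z \<subseteq> B"
    and C: "linked E C" "C \<inter> B = {}"
    and touch: "\<exists>u \<in> C. \<exists>v \<in> B. E u v"
    and no_touch: "\<And>u v. u \<in> C \<Longrightarrow> v \<in> B' \<Longrightarrow> \<not> E u v"
  obtains K Y where "K \<subseteq> B" "K \<noteq> {}" "linked E (C \<union> K)" "Y \<subseteq> K \<inter> Z" "bay (X - C \<union> Y) (B - K)"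
proof -
  define A where "A = {v \<in> B. \<exists>u \<in> C. E u v}"
  define F where "F = {T. linked E T \<and> T \<subseteq> B - B' \<and> T \<inter> A \<noteq> {}}"
  define K where "K = \<Union>F"
  define B'' where "B'' = B - K"
  \<comment> \<open>Of the swallowed vertices only those seen by the new bay have to be
    deleted.\<close>
  define Y where "Y = {v \<in> K. \<exists>u \<in> B''. E u v}"
  have KB: "K \<subseteq> B - B'"
    by (auto simp: K_def F_def)
  \<comment> \<open>The vertices where \<open>C\<close> attaches lie outside \<open>B'\<close> by
    \<open>no_touch\<close>, so each of them alone is a piece in \<open>F\<close>.\<close>
  have AK: "A \<subseteq> K"
  proof
    fix v assume "v \<in> A"
    then have "{v} \<in> F"
      using no_touch by (auto simp: F_def A_def)
    then show "v \<in> K" by (auto simp: K_def)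
  qed
  have K_closed: "v \<in> K" if "u \<in> K" "E u v" "v \<in> B - B'" for u v
  proof -
    obtain T where "T \<in> F" "u \<in> T"
      using \<open>u \<in> K\<close> by (auto simp: K_def)
    then have "insert v T \<in> F"
      using linked_insert[of T u v] that by (auto simp: F_def)
    then show ?thesis by (auto simp: K_def)
  qed
  have B_closed: "v \<in> B \<union> X" if "u \<in> B" "E u v" for u v
    using B that unfolding bay_def by blast
  have linked_B: "linked E B" and linked_B': "linked E B'"
    using B B'(1) unfolding bay_def by auto
  then have "B' \<noteq> {}" by (simp add: linked_def)
  then obtain x where x: "x \<in> B'" by auto
  have B'': "B' \<subseteq> B''" "B'' \<subseteq> B"
    using KB B'(2) by (auto simp: B''_def)
  have "linked E (C \<union> K)"
    unfolding K_def by (rule linked_Union[OF C(1)]) (auto simp: F_def A_def)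
  moreover have "K \<noteq> {}"
    using AK touch by (auto simp: A_def)
  \<comment> \<open>A neighbour of \<open>K\<close> in \<open>B''\<close> must lie in
    \<open>B'\<close>, since closure would otherwise put it into \<open>K\<close>. The neighbours of
    the bay \<open>B'\<close> outside it lie in \<open>X \<union> Z\<close>, and \<open>X\<close> is
    disjoint from \<open>B\<close>.\<close>
  moreover have YZ: "Y \<subseteq> K \<inter> Z"
  proof
    fix z assume "z \<in> Y"
    then obtain u where z: "z \<in> K" "u \<in> B''" "E u z" by (auto simp: Y_def)
    then have "u \<in> B'"
      using K_closed[of z u] sym[of u z] by (auto simp: B''_def)
    then have "z \<in> B' \<union> (X \<union> Z)"
      using B'(1) z(3) unfolding bay_def by blast
    then show "z \<in> K \<inter> Z"
      using z(1) KB B unfolding bay_def by blast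
  qed
  moreover have "linked E B''"
  proof (rule linkedI[of x])
    show "x \<in> B''" using x B'' by auto
    fix S assume S: "x \<in> S" "S \<subset> B''"
    show "\<exists>u \<in> S. \<exists>v \<in> B'' - S. E u v"
    proof (cases "B' \<subseteq> S")
      case False
      then obtain y where "y \<in> B'" "y \<notin> S" by auto
      then obtain u v where "u \<in> B' \<inter> S" "v \<in> B' - S" "E u v"
        using linked_cross[OF linked_B'] x S(1) by metis
      then show ?thesis using B'' by blast
    next
      case True
      \<comment> \<open>Connectivity of \<open>B\<close> is applied to the cut
        \<open>B'' - S\<close>. If the crossing edge ended in \<open>K\<close>, closure would put
        its other end into \<open>K\<close> too; so it ends in \<open>S\<close>.\<close>
      obtain y where y: "y \<in> B''" "y \<notin> S" using S by auto
      have "y \<in> B" "y \<in> B'' - S" "x \<in> B" "x \<notin> B'' - S"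
        using y S x B'' by auto
      then obtain u v where uv: "u \<in> B \<inter> (B'' - S)" "v \<in> B - (B'' - S)" "E u v"
        using linked_cross[OF linked_B] by metis
      have "v \<notin> K"
        using K_closed[of v u] sym uv True by (auto simp: B''_def)
      then have "v \<in> S" using uv by (auto simp: B''_def)
      then show ?thesis using uv sym by blast
    qed
  qed
  \<comment> \<open>A neighbour in \<open>C\<close> would make \<open>u\<close> an attachment vertex
    and thus an element of \<open>K\<close>. This is why \<open>C\<close> can be removed from
    \<open>X\<close>.\<close>
  moreover have "v \<in> B'' \<union> (X - C \<union> Y)" if "u \<in> B''" "E u v" for u v
  proof (cases "v \<in> B")
    case True
    then show ?thesis using that by (auto simp: B''_def Y_def)
  next
    case False
    then have "v \<in> X" using B_closed that B'' by blast
    moreover have "u \<notin> A" using that AK by (auto simp: B''_def)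
    ultimately show ?thesis
      using that sym B'' by (auto simp: A_def)
  qed
  moreover have "X \<subseteq> V" "B \<subseteq> V" "B \<inter> X = {}"
    using B unfolding bay_def by auto
  moreover have "\<exists>H \<in> eggs. H \<subseteq> B''"
    using B'(1) B''(1) unfolding bay_def by blast
  ultimately show thesis
    using that[of K Y] KB B'' unfolding bay_def B''_def by blast
qed

text \<open>Vertices without neighbours in \<open>B\<close> do not bound it and can be released from
  \<open>X\<close>.\<close>

lemma bay_drop:
  assumes B: "bay X B" and "\<And>u v. u \<in> C \<Longrightarrow> v \<in> B \<Longrightarrow> \<not> E u v"
  shows "bay (X - C) B"
  using assms sym unfolding bay_def by blast

section \<open>The invariant: a complete model whose branch sets share the boundary of a bay\<close>

definition bay_model :: "nat \<Rightarrow> 'a set set \<Rightarrow> 'a set \<Rightarrow> 'a set \<Rightarrow> bool" where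
  "bay_model s M X B \<longleftrightarrow> complete_model E M \<and> bay X B \<and> X \<subseteq> \<Union>M \<and> finite M \<and>
     (\<forall>C \<in> M. C \<subseteq> V \<and> C \<inter> B = {} \<and> card (C \<inter> X) \<le> s)"

text \<open>Every vertex of \<open>X\<close> is charged to a branch set containing it.\<close>

lemma bay_model_card:
  assumes "bay_model s M X B"
  shows "card X \<le> card M * s"
proof -
  have M: "finite M" "X \<subseteq> \<Union>M" "\<And>C. C \<in> M \<Longrightarrow> card (C \<inter> X) \<le> s"
    using assms by (auto simp: bay_model_def)
  have "X = (\<Union>C\<in>M. C \<inter> X)"
    using M(2) by auto
  then have "card X = card (\<Union>C\<in>M. C \<inter> X)" by simp
  also have "\<dots> \<le> (\<Sum>C\<in>M. card (C \<inter> X))"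
    by (rule card_UN_le[OF M(1)])
  also have "\<dots> \<le> (\<Sum>C\<in>M. s)"
    by (rule sum_mono) (rule M(3))
  finally show ?thesis by simp
qed

text \<open>A branch set that has lost contact with the bay is given up together with its share of
  \<open>X\<close>.\<close>

lemma bay_model_drop:
  assumes M: "bay_model s M X B" and C: "\<And>u v. u \<in> C \<Longrightarrow> v \<in> B \<Longrightarrow> \<not> E u v"
  shows "bay_model s (M - {C}) (X - C) B"
  unfolding bay_model_def
proof (intro conjI ballI)
  show "complete_model E (M - {C})"
    using M complete_model_subset[of E M "M - {C}"] by (auto simp: bay_model_def)
  show "bay (X - C) B"
    using M C bay_drop by (simp add: bay_model_def)
  show "X - C \<subseteq> \<Union>(M - {C})" "finite (M - {C})"
    using M by (auto simp: bay_model_def)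
  fix D assume D: "D \<in> M - {C}"
  then show "D \<subseteq> V" "D \<inter> B = {}"
    using M by (auto simp: bay_model_def)
  have "finite D"
    using finite_subset[OF \<open>D \<subseteq> V\<close> finite_V] .
  then have "card (D \<inter> (X - C)) \<le> card (D \<inter> X)"
    by (intro card_mono) auto
  also have "\<dots> \<le> s"
    using M D by (auto simp: bay_model_def)
  finally show "card (D \<inter> (X - C)) \<le> s" .
qed

text \<open>The new branch set lies in the old bay, so it is disjoint from the others and leaves
  their shares of \<open>X\<close> unchanged. Its own share is all of \<open>T\<close>.\<close>

lemma bay_model_insert:
  assumes M: "bay_model s M X B"
    and T: "linked E T" "T \<subseteq> B" "card T \<le> s" "\<And>C. C \<in> M \<Longrightarrow> \<exists>u \<in> C. \<exists>v \<in> T. E u v"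
    and B': "bay (X \<union> T) B'" "B' \<subseteq> B"
  shows "bay_model s (insert T M) (X \<union> T) B'"
  unfolding bay_model_def
proof (intro conjI ballI)
  have disj: "C \<inter> B = {}" "card (C \<inter> X) \<le> s" "C \<subseteq> V" if "C \<in> M" for C
    using M that by (auto simp: bay_model_def)
  have BX: "B \<inter> X = {}" "B \<subseteq> V"
    using M by (auto simp: bay_model_def bay_def)
  show "complete_model E (insert T M)"
  proof (rule complete_model_insert)
    show "complete_model E M" using M by (simp add: bay_model_def)
    fix C assume "C \<in> M"
    then show "C \<inter> T = {} \<and> (\<exists>u \<in> C. \<exists>v \<in> T. E u v)"
      using T(2) T(4) disj by blast
  qed (rule T(1))
  show "bay (X \<union> T) B'" by (rule B'(1))
  show "X \<union> T \<subseteq> \<Union>(insert T M)" "finite (insert T M)"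
    using M by (auto simp: bay_model_def)
  fix C assume C: "C \<in> insert T M"
  then show "C \<subseteq> V"
    using T(2) BX(2) disj(3) by auto
  have "B' \<inter> (X \<union> T) = {}"
    using B'(1) by (simp add: bay_def)
  then show "C \<inter> B' = {}"
    using C disj(1) B'(2) by blast
  show "card (C \<inter> (X \<union> T)) \<le> s"
  proof (cases "C = T")
    case True
    then have "C \<inter> (X \<union> T) = T" by auto
    then show ?thesis using T(3) by simp
  next
    case False
    then have "C \<inter> (X \<union> T) = C \<inter> X"
      using C disj(1) T(2) by blast
    then show ?thesis using False C disj(2) by simp
  qed
qed

text \<open>The old share of \<open>C\<close> is released and the new share of
  \<open>C \<union> K\<close> lies in \<open>Z\<close>. The other shares do not grow, because
  \<open>Y\<close> lies in the bay.\<close>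

lemma bay_model_replace:
  assumes M: "bay_model s M X B" and C: "C \<in> M"
    and K: "K \<subseteq> B" "linked E (C \<union> K)" "Y \<subseteq> K \<inter> Z" "card Z \<le> s" "Z \<subseteq> B"
    and bay': "bay (X - C \<union> Y) (B - K)"
  shows "bay_model s (insert (C \<union> K) (M - {C})) (X - C \<union> Y) (B - K)"
  unfolding bay_model_def
proof (intro conjI ballI)
  have disj: "C \<inter> B = {}" "card (C \<inter> X) \<le> s" "C \<subseteq> V" if "C \<in> M" for C
    using M that by (auto simp: bay_model_def)
  have pair: "D \<inter> C = {}" if "D \<in> M - {C}" for D
    using M C that by (auto simp: bay_model_def complete_model_def pairwise_def)
  have BX: "B \<inter> X = {}" "B \<subseteq> V"
    using M by (auto simp: bay_model_def bay_def)
  show "complete_model E (insert (C \<union> K) (M - {C}))"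
  proof (rule complete_model_replace[OF _ C _ K(2)])
    show "complete_model E M" using M by (simp add: bay_model_def)
    fix D assume D: "D \<in> M - {C}"
    then have "D \<inter> B = {}" using disj by auto
    then show "D \<inter> (C \<union> K) = {}" using K(1) pair[OF D] by blast
  qed simp
  show "bay (X - C \<union> Y) (B - K)" by (rule bay')
  show "X - C \<union> Y \<subseteq> \<Union>(insert (C \<union> K) (M - {C}))" "finite (insert (C \<union> K) (M - {C}))"
    using M K(3) by (auto simp: bay_model_def)
  fix D assume D: "D \<in> insert (C \<union> K) (M - {C})"
  then show DV: "D \<subseteq> V"
    using K(1) BX(2) disj(3) C by auto
  show "D \<inter> (B - K) = {}"
    using D disj(1) C by blast
  have fin: "finite X" "finite Z"
    using M finite_subset[OF _ finite_V] K(5) BX(2) by (auto simp: bay_model_def bay_def)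
  show "card (D \<inter> (X - C \<union> Y)) \<le> s"
  proof (cases "D = C \<union> K")
    case True
    then have "D \<inter> (X - C \<union> Y) \<subseteq> Z"
      using K(1,3) BX(1) by blast
    then show ?thesis using card_mono[OF fin(2)] K(4) by (meson order_trans)
  next
    case False
    then have "D \<inter> (X - C \<union> Y) \<subseteq> D \<inter> X"
      using D disj(1) K(1,3) by blast
    moreover have "finite (D \<inter> X)" "card (D \<inter> X) \<le> s"
      using fin False D disj(2) by auto
    ultimately show ?thesis using card_mono by (meson order_trans)
  qed
qed

text \<open>The measure is lexicographic: one vertex of the bay weighs \<open>Suc r\<close>, more
  than any model of size at most \<open>r\<close>. Inserting or enlarging a branch set shrinks the
  bay; dropping one keeps the bay and shrinks the model.\<close>

lemma bay_model_extend:
  assumes "bay_model s M X B" "card M < r" "r * s \<le> w" "r * card V \<le> s * s" "0 < s"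
  shows "\<exists>M'. complete_model E M' \<and> \<Union>M' \<subseteq> V \<and> finite M' \<and> card M' = r"
  using assms(1,2)
proof (induction "card B * Suc r + card M" arbitrary: M X B rule: less_induct)
  case less
  note M = less.prems(1)
  have bay: "bay X B" and fin_M: "finite M"
    using M by (auto simp: bay_model_def)
  have BV: "B \<subseteq> V" "B \<noteq> {}"
    using bay by (auto simp: bay_def linked_def)
  have fin_B: "finite B"
    using BV finite_V finite_subset by auto
  have card_B: "card B \<le> card V"
    using BV finite_V card_mono by auto
  \<comment> \<open>As the model has fewer than \<open>r\<close> members, \<open>X\<close> leaves
    room for one more set of size \<open>s\<close>.\<close>
  have fits: "card (X \<union> Z) \<le> w" if "card Z \<le> s" for Z
  proof -
    have "card (X \<union> Z) \<le> card M * s + s"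
      using card_Un_le[of X Z] bay_model_card[OF M] that by linarith
    also have "\<dots> = Suc (card M) * s" by simp
    also have "\<dots> \<le> r * s"
      using less.prems(2) by (intro mult_right_mono) auto
    finally show ?thesis using assms(3) by simp
  qed
  have smaller: "card B' * Suc r + c < card B * Suc r + card M" if "B' \<subset> B" "c \<le> r" for B' c
  proof -
    have "Suc (card B') \<le> card B"
      using psubset_card_mono[OF fin_B that(1)] by simp
    then have "Suc (card B') * Suc r \<le> card B * Suc r"
      by (rule mult_right_mono) simp
    then show ?thesis using that(2) by simp
  qed
  show ?case
  proof (cases "\<exists>C \<in> M. \<forall>u \<in> C. \<forall>v \<in> B. \<not> E u v")
    case True
    then obtain C where C: "C \<in> M" "\<And>u v. u \<in> C \<Longrightarrow> v \<in> B \<Longrightarrow> \<not> E u v"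
      by auto
    have card: "card (M - {C}) < card M"
      using C(1) fin_M by (meson card_Diff1_less)
    show ?thesis
    proof (rule less.hyps)
      show "bay_model s (M - {C}) (X - C) B"
        using bay_model_drop[OF M C(2)] .
    qed (use card less.prems(2) in auto)
  next
    case False
    then have touch: "\<exists>u \<in> C. \<exists>v \<in> B. E u v" if "C \<in> M" for C
      using that by blast
    obtain c where "bij_betw c {0..<card M} M"
      using ex_bij_betw_nat_finite[OF fin_M] by auto
    then have c: "M = c ` {..<card M}"
      by (simp add: bij_betw_def atLeast0LessThan)
    show ?thesis
    \<comment> \<open>The sets to be met are the attachments of the branch sets in the bay, so a
      linked set meeting all of them is adjacent to every branch set.\<close>
    proof (cases rule: small_linked_set_or_separator[OF fin_B BV(2) assms(5),
          where k = "card M" and A = "\<lambda>i. {v \<in> B. \<exists>u \<in> c i. E u v}",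
          case_names linked_set separator])
      case (linked_set T)
      have T: "\<exists>u \<in> C. \<exists>v \<in> T. E u v" if C: "C \<in> M" for C
      proof -
        obtain i where "i < card M" "C = c i" using c C by auto
        then show ?thesis using linked_set(4)[of i] by auto
      qed
      obtain B' where B': "bay (X \<union> T) B'" "B' \<subseteq> B"
        using bay_shrink[OF bay linked_set(2) fits[OF linked_set(3)]] .
      have M': "bay_model s (insert T M) (X \<union> T) B'"
        using bay_model_insert[OF M linked_set(1-3) T B'] .
      have "T \<inter> B' = {}" "T \<noteq> {}"
        using B'(1) linked_set(1) by (auto simp: bay_def linked_def)
      then have psub: "B' \<subset> B"
        using B'(2) linked_set(2) by blast
      have "T \<notin> M"
        using M linked_set(2) \<open>T \<noteq> {}\<close> by (auto simp: bay_model_def)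
      then have card: "card (insert T M) = Suc (card M)"
        using fin_M by simp
      show ?thesis
      proof (cases "Suc (card M) = r")
        case True
        then show ?thesis
          using M' card by (intro exI[of _ "insert T M"]) (auto simp: bay_model_def)
      next
        case False
        then have "Suc (card M) < r" using less.prems(2) by simp
        then show ?thesis
          using less.hyps[OF _ M'] smaller[OF psub, of "Suc (card M)"] card by simp
      qed
    next
      case (separator Z)
      \<comment> \<open>Here \<open>r * card V \<le> s * s\<close> makes the separator small enough
        to serve as a share of \<open>X\<close>.\<close>
      have "s * card Z \<le> r * card V"
        using separator(2) mult_mono[of "card M" r "card B" "card V"] less.prems(2) card_B by linarith
      then have "s * card Z \<le> s * s"
        using assms(4) by linarith
      then have Z: "card Z \<le> s"
        using assms(5) by simp
      obtain B' where B': "bay (X \<union> Z) B'" "B' \<subseteq> B"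
        using bay_shrink[OF bay separator(1) fits[OF Z]] .
      \<comment> \<open>The new bay is linked and avoids the separator, so it misses the attachment
        of some branch set, which then swallows part of \<open>Z\<close>.\<close>
      have "linked E B'" "B' \<subseteq> B - Z"
        using B' by (auto simp: bay_def)
      from separator(3)[OF this] obtain i where i: "i < card M"
        "B' \<inter> {v \<in> B. \<exists>u \<in> c i. E u v} = {}" by auto
      define C where "C = c i"
      have C: "C \<in> M" using c i(1) by (auto simp: C_def)
      have no_touch: "\<not> E u v" if "u \<in> C" "v \<in> B'" for u v
        using that i(2) B'(2) by (auto simp: C_def)
      have C': "linked E C" "C \<inter> B = {}"
        using M C by (auto simp: bay_model_def complete_model_def)
      obtain K Y where K: "K \<subseteq> B" "K \<noteq> {}" "linked E (C \<union> K)" "Y \<subseteq> K \<inter> Z"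
        "bay (X - C \<union> Y) (B - K)"
        using bay_swallow[OF bay B' separator(1) C' touch[OF C] no_touch] .
      let ?M = "insert (C \<union> K) (M - {C})"
      have M': "bay_model s ?M (X - C \<union> Y) (B - K)"
        using bay_model_replace[OF M C K(1,3,4) Z separator(1) K(5)] .
      have "card ?M \<le> Suc (card (M - {C}))"
        by (simp add: card_insert_le_m1 card_insert_if fin_M)
      also have "\<dots> = card M"
        by (rule card_Suc_Diff1[OF fin_M C])
      finally have card: "card ?M \<le> card M" .
      have "B - K \<subset> B" using K(1,2) by auto
      moreover have "card ?M < r" using card less.prems(2) by simp
      moreover from this have "card ?M \<le> r" by simp
      ultimately show ?thesis
        using less.hyps[OF smaller M'] by simp
    qed
  qed
qed

text \<open>The iteration starts from the empty model with nothing deleted, where connectivity makes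
  the whole of \<open>V\<close> a bay.\<close>

lemma ex_complete_model:
  assumes "linked E V" "0 < r" "r * s \<le> w" "r * card V \<le> s * s" "0 < s"
  shows "\<exists>M. complete_model E M \<and> \<Union>M \<subseteq> V \<and> finite M \<and> card M = r"
proof (rule bay_model_extend)
  obtain H where "H \<in> eggs"
    using avoid[of "{}"] by auto
  then show "bay_model s {} {} V"
    using assms(1) egg in_V by (auto simp: bay_model_def bay_def complete_model_def)
qed (use assms in auto)

end

section \<open>Contracting branch sets\<close>

text \<open>The doubletons forget the orientation. A loop makes its vertex adjacent to itself, which
  matters after contractions.\<close>

definition arc_adj :: "('a, 'b) pre_digraph \<Rightarrow> 'a \<Rightarrow> 'a \<Rightarrow> bool" where
  "arc_adj G u v \<longleftrightarrow> (\<exists>e \<in> arcs G. {tail G e, head G e} = {u, v})"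

lemma arc_adjI: "e \<in> arcs G \<Longrightarrow> arc_adj G (tail G e) (head G e)"
  unfolding arc_adj_def by blast

lemma arc_adj_sym: "arc_adj G u v \<Longrightarrow> arc_adj G v u"
  unfolding arc_adj_def by (simp add: insert_commute)

lemma (in wf_digraph) arc_adj_in_verts: "arc_adj G u v \<Longrightarrow> u \<in> verts G \<and> v \<in> verts G"
  unfolding arc_adj_def by (auto simp: doubleton_eq_iff)

lemma arc_adj_subgraph: "subgraph H G \<Longrightarrow> arc_adj H u v \<Longrightarrow> arc_adj G u v"
  unfolding arc_adj_def subgraph_def compatible_def by auto

text \<open>A cut of the image is pulled back along \<open>\<phi>\<close>. Vertices merged by
  \<open>\<phi>\<close> are never separated by it, so adjacency is demanded only for distinct
  images.\<close>

lemma linked_image: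
  assumes "linked E K" and E': "\<And>u v. u \<in> K \<Longrightarrow> v \<in> K \<Longrightarrow> \<phi> u \<noteq> \<phi> v \<Longrightarrow> E u v \<Longrightarrow> E' (\<phi> u) (\<phi> v)"
  shows "linked E' (\<phi> ` K)"
  unfolding linked_def
proof (intro conjI allI impI)
  show "\<phi> ` K \<noteq> {}" using assms(1) by (simp add: linked_def)
  fix S assume S: "S \<noteq> {} \<and> S \<subset> \<phi> ` K"
  then obtain a b where "a \<in> K" "\<phi> a \<in> S" "b \<in> K" "\<phi> b \<notin> S" by blast
  then obtain u v where "u \<in> K \<inter> \<phi> -` S" "v \<in> K - \<phi> -` S" "E u v"
    using linked_cross[OF assms(1), of a "\<phi> -` S" b] by auto
  then have uv: "u \<in> K" "\<phi> u \<in> S" "v \<in> K" "\<phi> v \<notin> S" "E u v" by auto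
  then have "E' (\<phi> u) (\<phi> v)" by (intro E') auto
  then show "\<exists>u \<in> S. \<exists>v \<in> \<phi> ` K - S. E' u v"
    using uv by blast
qed

text \<open>The branch sets are indexed so that \<open>I\<close>, and with it their number, stays
  fixed while the graph is being reduced.\<close>

definition branch_sets :: "('a, 'b) pre_digraph \<Rightarrow> 'i set \<Rightarrow> ('i \<Rightarrow> 'a set) \<Rightarrow> bool" where
  "branch_sets H I f \<longleftrightarrow>
     (\<forall>i \<in> I. linked (arc_adj H) (f i) \<and> f i \<subseteq> verts H) \<and>
     (\<forall>i \<in> I. \<forall>j \<in> I. i \<noteq> j \<longrightarrow> f i \<inter> f j = {} \<and> (\<exists>u \<in> f i. \<exists>v \<in> f j. arc_adj H u v))"

text \<open>The common transport principle for minor operations: \<open>\<phi>\<close> merges the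
  ends of an arc for a contraction and is the identity for deletions.\<close>

lemma branch_sets_image:
  assumes f: "branch_sets H I f"
    and verts: "\<And>i. i \<in> I \<Longrightarrow> \<phi> ` f i \<subseteq> verts H'"
    and inj: "\<And>i j u v. i \<in> I \<Longrightarrow> j \<in> I \<Longrightarrow> u \<in> f i \<Longrightarrow> v \<in> f j \<Longrightarrow> \<phi> u = \<phi> v \<Longrightarrow> i = j"
    and adj: "\<And>i j u v. i \<in> I \<Longrightarrow> j \<in> I \<Longrightarrow> u \<in> f i \<Longrightarrow> v \<in> f j \<Longrightarrow> \<phi> u \<noteq> \<phi> v \<Longrightarrow>
      arc_adj H u v \<Longrightarrow> arc_adj H' (\<phi> u) (\<phi> v)"
  shows "branch_sets H' I (\<lambda>i. \<phi> ` f i)"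
  unfolding branch_sets_def
proof (intro conjI ballI impI)
  fix i assume i: "i \<in> I"
  have "linked (arc_adj H) (f i)"
    using f i by (simp add: branch_sets_def)
  then show "linked (arc_adj H') (\<phi> ` f i)"
    by (rule linked_image) (use adj i in blast)
  show "\<phi> ` f i \<subseteq> verts H'" using verts i .
  fix j assume j: "j \<in> I" "i \<noteq> j"
  show "\<phi> ` f i \<inter> \<phi> ` f j = {}"
    using inj i j by blast
  obtain u v where uv: "u \<in> f i" "v \<in> f j" "arc_adj H u v"
    using f i j unfolding branch_sets_def by blast
  then have "\<phi> u \<noteq> \<phi> v" using inj i j by blast
  then show "\<exists>u \<in> \<phi> ` f i. \<exists>v \<in> \<phi> ` f j. arc_adj H' u v"
    using adj i j uv by blast
qed

lemma branch_sets_mono: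
  assumes "branch_sets H I f" "\<And>i. i \<in> I \<Longrightarrow> f i \<subseteq> verts H'"
    and "\<And>i j u v. i \<in> I \<Longrightarrow> j \<in> I \<Longrightarrow> u \<in> f i \<Longrightarrow> v \<in> f j \<Longrightarrow> u \<noteq> v \<Longrightarrow>
      arc_adj H u v \<Longrightarrow> arc_adj H' u v"
  shows "branch_sets H' I f"
proof -
  have "branch_sets H' I (\<lambda>i. (\<lambda>x. x) ` f i)"
  proof (rule branch_sets_image[OF assms(1)])
    fix i j u v assume "i \<in> I" "j \<in> I" "u \<in> f i" "v \<in> f j" "u = v"
    then have "f i \<inter> f j \<noteq> {}" by auto
    then show "i = j"
      using assms(1) \<open>i \<in> I\<close> \<open>j \<in> I\<close> unfolding branch_sets_def by blast
  qed (use assms(2,3) in auto)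
  then show ?thesis by simp
qed

section \<open>Effect of the minor operations on graph size and branch sets\<close>

definition merge_ends :: "('a, 'b) pre_digraph \<Rightarrow> 'b \<Rightarrow> 'a \<Rightarrow> 'a" where
  "merge_ends G e x = (if x = head G e then tail G e else x)"

lemma contract_arc_simps:
  "verts (contract_arc G e) = merge_ends G e ` verts G"
  "arcs (contract_arc G e) = arcs G - {e}"
  "tail (contract_arc G e) = merge_ends G e \<circ> tail G"
  "head (contract_arc G e) = merge_ends G e \<circ> head G"
  unfolding contract_arc_def Let_def merge_ends_def by (simp_all add: fun_eq_iff)

lemma fin_digraph_contract_arc:
  assumes "fin_digraph H" "e \<in> arcs H"
  shows "fin_digraph (contract_arc H e)"
proof -
  interpret fin_digraph H by fact
  show ?thesis
    by unfold_locales (auto simp: contract_arc_simps)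
qed

lemma (in fin_digraph) card_del_vert:
  assumes "v \<in> verts G"
  shows "card (verts (del_vert v)) + card (arcs (del_vert v)) < card (verts G) + card (arcs G)"
proof -
  have "card (verts (del_vert v)) < card (verts G)"
    using assms finite_verts unfolding del_vert_def by (simp add: card_Diff1_less del: card_Diff_singleton card_Diff_insert)
  moreover have "card (arcs (del_vert v)) \<le> card (arcs G)"
    using finite_arcs by (intro card_mono) (auto simp: del_vert_def)
  ultimately show ?thesis by simp
qed

lemma (in fin_digraph) card_contract_arc:
  assumes "e \<in> arcs G"
  shows "card (verts (contract_arc G e)) + card (arcs (contract_arc G e)) < card (verts G) + card (arcs G)"
proof -
  have "card (arcs (contract_arc G e)) < card (arcs G)"
    using assms finite_arcs by (simp add: contract_arc_simps card_Diff1_less del: card_Diff_singleton card_Diff_insert)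
  moreover have "card (verts (contract_arc G e)) \<le> card (verts G)"
    using finite_verts by (simp add: contract_arc_simps card_image_le)
  ultimately show ?thesis by simp
qed

lemma (in fin_digraph) card_del_arc:
  assumes "e \<in> arcs G"
  shows "card (verts (del_arc e)) + card (arcs (del_arc e)) < card (verts G) + card (arcs G)"
proof -
  have "card (arcs (del_arc e)) < card (arcs G)"
    using assms finite_arcs by (simp add: card_Diff1_less del: card_Diff_singleton card_Diff_insert)
  then show ?thesis by (simp add: del_arc_def)
qed

text \<open>Merging two vertices of one branch set cannot make two branch sets overlap. An arc whose
  ends stay distinct is not \<open>e\<close> and survives.\<close>

lemma branch_sets_contract_arc:
  assumes f: "branch_sets H I f" and e: "e \<in> arcs H" "i \<in> I" "tail H e \<in> f i" "head H e \<in> f i"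
  shows "branch_sets (contract_arc H e) I (\<lambda>j. merge_ends H e ` f j)"
proof (rule branch_sets_image[OF f])
  let ?\<phi> = "merge_ends H e"
  fix j assume j: "j \<in> I"
  show "?\<phi> ` f j \<subseteq> verts (contract_arc H e)"
    using f j unfolding branch_sets_def contract_arc_simps by auto
  fix k u v assume k: "k \<in> I" "u \<in> f j" "v \<in> f k"
  show "j = k" if "?\<phi> u = ?\<phi> v"
  proof (rule ccontr)
    assume "j \<noteq> k"
    then have "f j \<inter> f k = {}" "i \<noteq> j \<Longrightarrow> f i \<inter> f j = {}" "i \<noteq> k \<Longrightarrow> f i \<inter> f k = {}"
      using f j k(1) e(2) unfolding branch_sets_def by blast+
    then show False
      using k that e(3,4) by (auto simp: merge_ends_def split: if_splits)
  qed
  assume ne: "?\<phi> u \<noteq> ?\<phi> v" and "arc_adj H u v"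
  then obtain a where a: "a \<in> arcs H" "{tail H a, head H a} = {u, v}"
    by (auto simp: arc_adj_def)
  then have "a \<noteq> e"
    using ne by (auto simp: doubleton_eq_iff merge_ends_def)
  moreover have "{?\<phi> (tail H a), ?\<phi> (head H a)} = {?\<phi> u, ?\<phi> v}"
    using a(2) by (metis (no_types, lifting) image_empty image_insert)
  ultimately show "arc_adj (contract_arc H e) (?\<phi> u) (?\<phi> v)"
    using a(1) unfolding arc_adj_def contract_arc_simps by auto
qed

text \<open>A loop realises no adjacency between distinct vertices, and a parallel arc takes over
  those of \<open>e\<close>.\<close>

lemma branch_sets_del_arc:
  assumes f: "branch_sets H I f"
    and e: "tail H e = head H e \<or> (\<exists>e' \<in> arcs H - {e}. {tail H e', head H e'} = {tail H e, head H e})"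
  shows "branch_sets (pre_digraph.del_arc H e) I f"
proof (rule branch_sets_mono[OF f])
  fix i assume "i \<in> I"
  then show "f i \<subseteq> verts (pre_digraph.del_arc H e)"
    using f by (auto simp: branch_sets_def pre_digraph.del_arc_def)
next
  fix u v assume uv: "u \<noteq> v" "arc_adj H u v"
  then obtain a where a: "a \<in> arcs H" "{tail H a, head H a} = {u, v}"
    by (auto simp: arc_adj_def)
  have "\<exists>a \<in> arcs H - {e}. {tail H a, head H a} = {u, v}"
  proof (cases "a = e")
    case True
    then have "tail H e \<noteq> head H e" using a uv(1) by auto
    then show ?thesis using e a True by auto
  qed (use a in auto)
  then show "arc_adj (pre_digraph.del_arc H e) u v"
    by (simp add: arc_adj_def pre_digraph.del_arc_def)
qed

lemma branch_sets_del_vert: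
  assumes f: "branch_sets H I f" and v: "v \<notin> (\<Union>i\<in>I. f i)"
  shows "branch_sets (pre_digraph.del_vert H v) I f"
proof (rule branch_sets_mono[OF f])
  fix i assume "i \<in> I"
  then show "f i \<subseteq> verts (pre_digraph.del_vert H v)"
    using f v by (auto simp: branch_sets_def pre_digraph.del_vert_def)
next
  fix i j x y assume ij: "i \<in> I" "j \<in> I" "x \<in> f i" "y \<in> f j" "arc_adj H x y"
  then obtain a where a: "a \<in> arcs H" "{tail H a, head H a} = {x, y}"
    by (auto simp: arc_adj_def)
  moreover have "x \<noteq> v" "y \<noteq> v" using v ij by auto
  ultimately have "tail H a \<noteq> v" "head H a \<noteq> v"
    by (auto simp: doubleton_eq_iff)
  then show "arc_adj (pre_digraph.del_vert H v) x y"
    using a by (auto simp: arc_adj_def pre_digraph.del_vert_def)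
qed

text \<open>Each reduction lowers the number of vertices plus arcs: uncovered vertices are deleted,
  arcs inside a branch set are contracted or, if loops, deleted, and finally parallel arcs are
  deleted. When nothing applies, the graph is complete on \<open>card I\<close> vertices.\<close>

lemma complete_minor_of_branch_sets:
  assumes "fin_digraph H" "minor H G" "branch_sets H I f"
  shows "\<exists>H'. minor H' G \<and> complete_multigraph (card I) H'"
  using assms
proof (induction "card (verts H) + card (arcs H)" arbitrary: H f rule: less_induct)
  case less
  interpret fin_digraph H by fact
  note f = less.prems(3)
  have f_verts: "f i \<subseteq> verts H" and f_linked: "linked (arc_adj H) (f i)" if "i \<in> I" for i
    using f that by (auto simp: branch_sets_def)
  have f_disj: "f i \<inter> f j = {}" "\<exists>u \<in> f i. \<exists>v \<in> f j. arc_adj H u v"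
    if "i \<in> I" "j \<in> I" "i \<noteq> j" for i j
    using f that by (auto simp: branch_sets_def)
  show ?case
  proof (cases "verts H \<subseteq> (\<Union>i\<in>I. f i)")
    case False
    then obtain v where v: "v \<in> verts H" "v \<notin> (\<Union>i\<in>I. f i)" by auto
    show ?thesis
      by (rule less.hyps[OF card_del_vert[OF v(1)] fin_digraph_del_vert
            minor.del_vert[OF less.prems(2) v(1)] branch_sets_del_vert[OF f v(2)]])
  next
    case covered: True
    show ?thesis
    proof (cases "\<exists>e \<in> arcs H. \<exists>i \<in> I. tail H e \<in> f i \<and> head H e \<in> f i")
      case True
      then obtain e i where e: "e \<in> arcs H" "i \<in> I" "tail H e \<in> f i" "head H e \<in> f i" by auto
      show ?thesis
      proof (cases "tail H e = head H e")
        case True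
        show ?thesis
          by (rule less.hyps[OF card_del_arc[OF e(1)] fin_digraph_del_arc
                minor.del_arc[OF less.prems(2) e(1)] branch_sets_del_arc[OF f]]) (simp add: True)
      next
        case False
        show ?thesis
          by (rule less.hyps[OF card_contract_arc[OF e(1)] fin_digraph_contract_arc[OF less.prems(1) e(1)]
                minor.contract[OF less.prems(2) e(1) False] branch_sets_contract_arc[OF f e]])
      qed
    next
      case no_inner: False
      \<comment> \<open>A second vertex would, by connectivity, yield an arc inside the branch
        set.\<close>
      have "\<exists>x. f i = {x}" if i: "i \<in> I" for i
      proof -
        obtain x where x: "x \<in> f i"
          using f_linked[OF i] by (auto simp: linked_def)
        have "y = x" if "y \<in> f i" for y
        proof (rule ccontr)
          assume "y \<noteq> x"
          then obtain u v where "u \<in> f i" "v \<in> f i" "arc_adj H u v"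
            using linked_cross[OF f_linked[OF i] x, of "{x}" y] \<open>y \<in> f i\<close> by blast
          then show False
            using no_inner i by (auto simp: arc_adj_def doubleton_eq_iff)
        qed
        then show ?thesis using x by auto
      qed
      then obtain g where g: "\<And>i. i \<in> I \<Longrightarrow> f i = {g i}" by metis
      have g_inj: "inj_on g I"
        using f_disj(1) g by (fastforce simp: inj_on_def)
      have "verts H = g ` I"
        using covered f_verts g by auto
      then have card: "card (verts H) = card I"
        using g_inj by (simp add: card_image)
      show ?thesis
      proof (cases "\<exists>e \<in> arcs H. \<exists>e' \<in> arcs H - {e}. {tail H e', head H e'} = {tail H e, head H e}")
        case True
        then obtain e where e: "e \<in> arcs H"
          "\<exists>e' \<in> arcs H - {e}. {tail H e', head H e'} = {tail H e, head H e}" by auto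
        show ?thesis
          by (rule less.hyps[OF card_del_arc[OF e(1)] fin_digraph_del_arc
                minor.del_arc[OF less.prems(2) e(1)] branch_sets_del_arc[OF f]]) (simp add: e(2))
      next
        case simple: False
        have "loopfree_digraph H"
        proof
          fix e assume e: "e \<in> arcs H"
          then have "tail H e \<in> verts H" by simp
          then obtain i where "i \<in> I" "tail H e \<in> f i"
            using covered by auto
          then show "tail H e \<noteq> head H e" using no_inner e by metis
        qed
        moreover have "\<exists>!e. e \<in> arcs H \<and> {tail H e, head H e} = {u, v}"
          if uv: "u \<in> verts H" "v \<in> verts H" "u \<noteq> v" for u v
        proof -
          obtain i j where "i \<in> I" "j \<in> I" "u = g i" "v = g j" "i \<noteq> j"
            using uv \<open>verts H = g ` I\<close> by auto
          then have "arc_adj H u v"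
            using f_disj(2)[of i j] g by auto
          then obtain e where e: "e \<in> arcs H" "{tail H e, head H e} = {u, v}"
            by (auto simp: arc_adj_def)
          show ?thesis
          proof (rule ex1I[of _ e])
            fix e' assume "e' \<in> arcs H \<and> {tail H e', head H e'} = {u, v}"
            then show "e' = e"
              using simple e by (metis DiffI singletonD)
          qed (use e in simp)
        qed
        ultimately have "complete_multigraph (card I) H"
          unfolding complete_multigraph_def using card less.prems(1) by blast
        then show ?thesis using less.prems(2) by blast
      qed
    qed
  qed
qed

lemma has_complete_minor_of_model:
  assumes "fin_digraph G" "complete_model (arc_adj G) M" "\<Union>M \<subseteq> verts G"
  shows "has_complete_minor (card M) G"
proof -
  have "branch_sets G M (\<lambda>C. C)"
    unfolding branch_sets_def
  proof (intro conjI ballI impI)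
    fix C assume C: "C \<in> M"
    show "linked (arc_adj G) C" "C \<subseteq> verts G"
      using C assms(2,3) by (auto simp: complete_model_def)
    fix D assume "D \<in> M" "C \<noteq> D"
    then show "C \<inter> D = {}" "\<exists>u \<in> C. \<exists>v \<in> D. arc_adj G u v"
      using complete_modelD[OF assms(2) C] by auto
  qed
  from complete_minor_of_branch_sets[OF assms(1) minor.refl this] show ?thesis
    unfolding has_complete_minor_def .
qed

section \<open>Scrambles\<close>

text \<open>A walk from \<open>S\<close> to a vertex outside must use an arc across the cut.\<close>

lemma linked_of_connected:
  assumes "Digraph_Component.connected G"
  shows "linked (arc_adj G) (verts G)"
  unfolding linked_def
proof (intro conjI allI impI)
  show "verts G \<noteq> {}" using assms by (simp add: connected_conv)
  fix S assume S: "S \<noteq> {} \<and> S \<subset> verts G"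
  show "\<exists>u \<in> S. \<exists>v \<in> verts G - S. arc_adj G u v"
  proof (rule ccontr)
    assume closed: "\<not> ?thesis"
    obtain a b where ab: "a \<in> S" "b \<in> verts G" "b \<notin> S" using S by auto
    then have "(a, b) \<in> rtrancl_on (verts G) ((arcs_ends G)\<^sup>s)"
      using assms S by (auto simp: connected_conv)
    then have "b \<in> S"
    proof (induction rule: rtrancl_on_induct)
      case base
      show ?case by (rule ab(1))
    next
      case (step y z)
      then have "arc_adj G y z"
        using arc_adjI arc_adj_sym by (fastforce simp: symcl_def arcs_ends_conv)
      then show ?case using step closed by blast
    qed
    then show False using ab by simp
  qed
qed

text \<open>Among the connected subgraphs containing \<open>H\<close>, one with the most vertices
  and arcs is maximal; finiteness of \<open>G\<close> provides it.\<close>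

lemma ex_component_supergraph:
  assumes "fin_digraph G" "subgraph H G" "Digraph_Component.connected H"
  shows "\<exists>C. component G C \<and> subgraph H C"
proof -
  interpret fin_digraph G by fact
  let ?P = "\<lambda>C. subgraph C G \<and> Digraph_Component.connected C \<and> subgraph H C"
  let ?m = "\<lambda>C. card (verts C) + card (arcs C)"
  have "?P H"
    using assms by (auto simp: subgraph_def compatible_def)
  moreover have "\<forall>C. ?P C \<longrightarrow> ?m C \<le> ?m G"
    by (auto simp: subgraph_def intro!: add_mono card_mono)
  ultimately obtain C where C: "?P C" "\<And>C'. ?P C' \<Longrightarrow> ?m C' \<le> ?m C"
    using ex_has_greatest_nat[of ?P H ?m "Suc (?m G)"] by (metis less_Suc_eq_le)
  have "C' = C" if C': "subgraph C C'" "subgraph C' G" "Digraph_Component.connected C'" for C'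
  proof -
    have "?P C'"
      using C(1) C' subgraph_trans by blast
    then have le: "?m C' \<le> ?m C" by (rule C(2))
    have sub: "verts C \<subseteq> verts C'" "arcs C \<subseteq> arcs C'" "tail C = tail C'" "head C = head C'"
      using C'(1) by (auto simp: subgraph_def compatible_def)
    have fin: "finite (verts C')" "finite (arcs C')"
      using C'(2) finite_subset[OF _ finite_verts] finite_subset[OF _ finite_arcs]
      by (auto simp: subgraph_def)
    have "card (verts C) \<le> card (verts C')" "card (arcs C) \<le> card (arcs C')"
      using sub fin by (auto intro: card_mono)
    then have "card (verts C) = card (verts C')" "card (arcs C) = card (arcs C')"
      using le by auto
    then have "verts C = verts C'" "arcs C = arcs C'"
      using sub fin card_subset_eq by metis+
    then show ?thesis using sub by simp
  qed
  then have "component G C"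
    using C(1) unfolding component_def max_subgraph_def by blast
  then show ?thesis using C(1) by blast
qed

section \<open>From scrambles to egg families\<close>

lemma card_incident_arcs:
  assumes "fin_digraph G" "finite X" "\<And>x. x \<in> X \<Longrightarrow> degree G x \<le> D"
  shows "card (\<Union>x\<in>X. in_arcs G x \<union> out_arcs G x) \<le> D * card X"
proof -
  have "card (\<Union>x\<in>X. in_arcs G x \<union> out_arcs G x) \<le> (\<Sum>x\<in>X. card (in_arcs G x \<union> out_arcs G x))"
    by (rule card_UN_le[OF assms(2)])
  also have "\<dots> \<le> (\<Sum>x\<in>X. D)"
  proof (rule sum_mono)
    fix x assume "x \<in> X"
    then show "card (in_arcs G x \<union> out_arcs G x) \<le> D"
      using assms(3)[of x] card_Un_le[of "in_arcs G x" "out_arcs G x"]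
      by (simp add: degree_def in_degree_def out_degree_def)
  qed
  finally show ?thesis by (simp add: mult.commute)
qed

text \<open>Once the arcs at \<open>X\<close> are gone, no arc leaves \<open>B\<close>. The
  component containing \<open>H\<close> therefore stays inside \<open>B\<close>, while the one
  containing \<open>H'\<close> has vertices outside.\<close>

lemma egg_cut_incident_arcs:
  assumes G: "fin_digraph G" and S: "scramble G S"
    and B: "B \<inter> X = {}" "\<And>u v. u \<in> B \<Longrightarrow> arc_adj G u v \<Longrightarrow> v \<in> B \<union> X"
    and H: "H \<in> S" "verts H \<subseteq> B" and H': "H' \<in> S" "verts H' \<inter> X = {}" "verts H' \<inter> B = {}"
  shows "egg_cut G S (\<Union>x\<in>X. in_arcs G x \<union> out_arcs G x)"
proof -
  interpret fin_digraph G by fact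
  define F where "F = (\<Union>x\<in>X. in_arcs G x \<union> out_arcs G x)"
  let ?G = "delete_arcs G F"
  have arcs_G': "a \<in> arcs ?G \<longleftrightarrow> a \<in> arcs G \<and> tail G a \<notin> X \<and> head G a \<notin> X" for a
    by (auto simp: F_def delete_arcs_def)
  have [simp]: "verts ?G = verts G" "tail ?G = tail G" "head ?G = head G"
    by (auto simp: delete_arcs_def)
  have fin: "fin_digraph ?G"
  proof
    show "finite (arcs ?G)" by (simp add: delete_arcs_def)
  qed (auto simp: arcs_G')
  then have wf: "wf_digraph ?G" by (simp add: fin_digraph_def)
  \<comment> \<open>An egg avoiding \<open>X\<close> loses no arc, so it still lies in a
    component.\<close>
  have egg: "\<exists>C. component ?G C \<and> subgraph K C" if "K \<in> S" "verts K \<inter> X = {}" for K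
  proof (rule ex_component_supergraph[OF fin])
    have K: "subgraph K G"
      using that(1) S by (simp add: scramble_def)
    then interpret K: wf_digraph K by (simp add: subgraph_def)
    have [simp]: "tail K = tail G" "head K = head G"
      using K by (auto simp: subgraph_def compatible_def)
    have "tail G a \<notin> X \<and> head G a \<notin> X" if "a \<in> arcs K" for a
      using K.tail_in_verts[OF that] K.head_in_verts[OF that] \<open>verts K \<inter> X = {}\<close> by auto
    then have "arcs K \<subseteq> arcs ?G"
      using K by (auto simp: arcs_G' subgraph_def)
    then show "subgraph K ?G"
      using K wf by (auto simp: subgraph_def compatible_def)
    show "Digraph_Component.connected K"
      using that(1) S by (simp add: scramble_def)
  qed
  obtain C1 where C1: "component ?G C1" "subgraph H C1"
    using egg[OF H(1)] H(2) B(1) by blast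
  obtain C2 where C2: "component ?G C2" "subgraph H' C2"
    using egg[OF H'(1,2)] by blast
  have nonempty: "verts H \<noteq> {}" "verts H' \<noteq> {}"
    using S H(1) H'(1) by (auto simp: scramble_def connected_conv)
  have C1': "linked (arc_adj C1) (verts C1)" "subgraph C1 ?G"
    using C1(1) linked_of_connected by (auto simp: component_def pre_digraph.max_subgraph_def)
  have "verts C1 \<subseteq> B"
  proof (rule linked_subset_closed[OF C1'(1)])
    show "verts C1 \<inter> B \<noteq> {}"
      using C1(2) H(2) nonempty(1) by (auto simp: subgraph_def)
    fix u v assume u: "u \<in> B" and uv: "arc_adj C1 u v"
    have "arc_adj ?G u v"
      using arc_adj_subgraph[OF C1'(2) uv] .
    then obtain a where a: "a \<in> arcs ?G" "{tail G a, head G a} = {u, v}"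
      by (auto simp: arc_adj_def)
    then have "arc_adj G u v" "v \<notin> X"
      by (auto simp: arcs_G' arc_adj_def doubleton_eq_iff)
    then show "v \<in> B" using B(2)[OF u] by auto
  qed
  then have "C1 \<noteq> C2"
    using C2(2) H'(3) nonempty(2) by (auto simp: subgraph_def)
  moreover have "F \<subseteq> arcs G" by (auto simp: F_def)
  ultimately show ?thesis
    using C1 C2 H(1) H'(1) unfolding egg_cut_def F_def by blast
qed

text \<open>The number \<open>Suc D * w\<close> dominates both obstructions to the order: a hitting
  set of at most \<open>w\<close> vertices and an egg-cut of at most \<open>D * w\<close> arcs at
  such a set.\<close>

lemma (in multigraph) egg_family_of_scramble:
  assumes S: "scramble G S" and D: "max_degree G \<le> D"
    and order: "enat (Suc D * w) < scramble_order G S"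
  shows "egg_family (arc_adj G) (verts G) (verts ` S) w"
proof
  show "arc_adj G u v \<Longrightarrow> arc_adj G v u" for u v by (rule arc_adj_sym)
  show "finite (verts G)" by simp
  show "arc_adj G u v \<Longrightarrow> v \<in> verts G" for u v using arc_adj_in_verts by blast
  show "linked (arc_adj G) H \<and> H \<subseteq> verts G" if H: "H \<in> verts ` S" for H
  proof -
    obtain K where K: "K \<in> S" "H = verts K" using H by auto
    then have sub: "subgraph K G" and "linked (arc_adj K) (verts K)"
      using S linked_of_connected by (auto simp: scramble_def)
    then have "linked (arc_adj G) ((\<lambda>x. x) ` verts K)"
      using linked_image[of "arc_adj K" "verts K" "\<lambda>x. x" "arc_adj G"] arc_adj_subgraph by metis
    then show ?thesis using K(2) sub by (simp add: subgraph_def)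
  qed
  fix X assume X: "X \<subseteq> verts G" "card X \<le> w"
  have "w \<le> Suc D * w" by simp
  show "\<exists>H \<in> verts ` S. H \<inter> X = {}"
  proof (rule ccontr)
    assume "\<not> ?thesis"
    then have "hitting_set G S X"
      using X(1) by (auto simp: hitting_set_def)
    then have "scramble_order G S \<le> enat (card X)"
      unfolding scramble_order_def hitting_number_def by (intro min.coboundedI1 INF_lower) simp
    also have "\<dots> \<le> enat (Suc D * w)" using X(2) \<open>w \<le> Suc D * w\<close> by simp
    finally show False using order by simp
  qed
  fix B H H' assume B: "B \<inter> X = {}" "\<And>u v. u \<in> B \<Longrightarrow> arc_adj G u v \<Longrightarrow> v \<in> B \<union> X"
    and H: "H \<in> verts ` S" "H \<subseteq> B" and H': "H' \<in> verts ` S" "H' \<inter> X = {}"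
  show "H' \<inter> B \<noteq> {}"
  proof
    assume "H' \<inter> B = {}"
    let ?F = "\<Union>x\<in>X. in_arcs G x \<union> out_arcs G x"
    have "egg_cut G S ?F"
      using egg_cut_incident_arcs[OF fin_digraph_axioms S B] H H' \<open>H' \<inter> B = {}\<close> by auto
    then have cut: "scramble_order G S \<le> enat (card ?F)"
      unfolding scramble_order_def egg_cut_number_def by (intro min.coboundedI2 INF_lower) simp
    have "card ?F \<le> D * card X"
    proof (rule card_incident_arcs)
      show "fin_digraph G" by (rule fin_digraph_axioms)
      show "finite X" using X(1) finite_verts by (rule finite_subset)
      fix x assume "x \<in> X"
      then have "degree G x \<le> max_degree G"
        using X(1) unfolding max_degree_def by (intro Max_ge) auto
      then show "degree G x \<le> D" using D by simp
    qed
    also have "\<dots> \<le> Suc D * w"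
      using X(2) by (intro mult_mono) auto
    finally have "enat (card ?F) \<le> enat (Suc D * w)" by simp
    then show False using cut order by (meson leD order_trans)
  qed
qed

text \<open>A scramble of larger order would be an egg family with \<open>w = r * s\<close> and so
  produce the excluded complete minor.\<close>

lemma (in multigraph) scramble_number_le:
  assumes "max_degree G \<le> D" "\<not> has_complete_minor r G" "0 < r"
    and "0 < s" "r * card (verts G) \<le> s * s"
  shows "scramble_number G \<le> enat (Suc D * (r * s))"
  unfolding scramble_number_def
proof (rule SUP_least)
  fix S assume S: "S \<in> Collect (scramble G)"
  show "scramble_order G S \<le> enat (Suc D * (r * s))"
  proof (rule ccontr)
    assume "\<not> ?thesis"
    then interpret egg_family "arc_adj G" "verts G" "verts ` S" "r * s"
      using S assms(1) by (intro egg_family_of_scramble) auto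
    have "linked (arc_adj G) (verts G)"
      using conn by (rule linked_of_connected)
    then obtain M where "complete_model (arc_adj G) M" "\<Union>M \<subseteq> verts G" "card M = r"
      using ex_complete_model assms(3-5) by blast
    then show False
      using has_complete_minor_of_model[OF fin_digraph_axioms] assms(2) by auto
  qed
qed

section \<open>Choice of \<open>s\<close> and the asymptotic bound\<close>

lemma ex_nat_sqrt_bound:
  assumes "0 < m"
  obtains s :: nat where "0 < s" "m \<le> s * s" "real s \<le> 2 * sqrt (real m)"
proof
  \<comment> \<open>Rounding up costs at most 1, and \<open>sqrt (real m)\<close> is at least 1;
    hence the factor 2.\<close>
  define s where "s = nat \<lceil>sqrt (real m)\<rceil>"
  have m: "1 \<le> sqrt (real m)" using assms by simp
  have lower: "sqrt (real m) \<le> real s"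
    unfolding s_def by linarith
  then show "0 < s" using m by (cases s) auto
  have "real m = sqrt (real m) * sqrt (real m)" by simp
  also have "\<dots> \<le> real s * real s" using lower by (intro mult_mono) auto
  finally show "m \<le> s * s" by (metis of_nat_le_iff of_nat_mult)
  have "real s \<le> sqrt (real m) + 1"
    unfolding s_def using m by linarith
  then show "real s \<le> 2 * sqrt (real m)" using m by linarith
qed

theorem corollary7p5:
  fixes r :: nat and \<G> :: "('a, 'b) pre_digraph set"
  assumes "r > 0"
    and "\<forall>G \<in> \<G>. multigraph G"
    and "\<exists>D. \<forall>G \<in> \<G>. max_degree G \<le> D"
    and "\<forall>G \<in> \<G>. \<not> has_complete_minor r G"
  shows "\<exists>C :: real. \<forall>G \<in> \<G>.
    ereal_of_enat (scramble_number G) \<le> ereal (C * sqrt (real (card (verts G))))"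
proof -
  obtain D where D: "\<forall>G \<in> \<G>. max_degree G \<le> D"
    using assms(3) by auto
  \<comment> \<open>The first factor comes from the bound \<open>Suc D * (r * s)\<close>, the second
    from \<open>s \<le> 2 * sqrt (r * n)\<close> after splitting off \<open>sqrt n\<close>.\<close>
  let ?C = "real (Suc D * r) * (2 * sqrt (real r))"
  have "ereal_of_enat (scramble_number G) \<le> ereal (?C * sqrt (real (card (verts G))))" if G: "G \<in> \<G>" for G
  proof -
    let ?n = "card (verts G)"
    interpret multigraph G using assms(2) G by simp
    have "verts G \<noteq> {}" using conn by (simp add: connected_conv)
    then have "0 < r * ?n" using assms(1) by (simp add: card_gt_0_iff)
    then obtain s where s: "0 < s" "r * ?n \<le> s * s" "real s \<le> 2 * sqrt (real (r * ?n))"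
      by (rule ex_nat_sqrt_bound)
    have "scramble_number G \<le> enat (Suc D * (r * s))"
      using scramble_number_le assms(1,4) D G s by simp
    then have "ereal_of_enat (scramble_number G) \<le> ereal_of_enat (enat (Suc D * (r * s)))"
      by (simp only: ereal_of_enat_le_iff)
    also have "\<dots> = ereal (real (Suc D * r) * real s)"
      by (simp add: algebra_simps)
    also have "\<dots> \<le> ereal (real (Suc D * r) * (2 * sqrt (real (r * ?n))))"
      using s(3) by (simp add: mult_left_mono del: of_nat_mult)
    also have "real (Suc D * r) * (2 * sqrt (real (r * ?n))) = ?C * sqrt (real ?n)"
      by (simp add: real_sqrt_mult)
    finally show ?thesis .
  qed
  then show ?thesis by blast
qed

end
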